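(* Let $n,w,t$ be nonnegative integers with $t+w\le n\le 2w+t$, and let $q\ge 3$. Define $$A''_q(n,w,t)=\{(0,\dots,0,a_{t+1},\dots,a_n)\in\mathbb{Z}_q^n:\ \mathrm{wt}((a_{t+1},\dots,a_n))=w\}$$ (the first $t$ coordinates are $0$). Then: (1'') $A''_q(n,w,t)$ is an anticode of diameter $n-t$ in $J_q(n,w)$; (2'') $|A''_q(n,w,t)|=\binom{n-t}{w}(q-1)^w$; (3'') if $n\ge (n-w-t+1)(t+1)$ (equivalently $n\le (w+t-1)(t+1)/t$), then for all sufficiently large $q$, $A''_q(n,w,t)$ is a maximum anticode of diameter $n-t$ in $J_q(n,w)$.
   Context: $\mathbb{Z}_q=\{0,1,\dots,q-1\}$ is used merely as an alphabet. For $x\in\mathbb{Z}_q^n$, $\mathrm{supp}(x)=\{i\in[n]: x_i\ne 0\}$ and $\mathrm{wt}(x)=|\mathrm{supp}(x)|$; $d(x,y)$ is the Hamming distance. $J_q(n,w)$ denotes the set of words of $\mathbb{Z}_q^n$ of weight $w$, with the Hamming metric. An anticode of diameter $D$ is a nonempty subset in which all pairwise distances are at most $D$; it is maximum if it has the largest cardinality among all anticodes of diameter $D$ in the space. *)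

theory Defs
  imports Main
begin

text \<open>Words of Z_q^n: coordinates indexed 0..n-1 with values in {0..q-1};
  coordinates outside [0,n) are fixed to 0 so that each word has a unique representation.\<close>
definition words :: "nat \<Rightarrow> nat \<Rightarrow> (nat \<Rightarrow> nat) set" where
  "words q n = {x. (\<forall>i<n. x i < q) \<and> (\<forall>i. n \<le> i \<longrightarrow> x i = 0)}"

definition supp :: "nat \<Rightarrow> (nat \<Rightarrow> nat) \<Rightarrow> nat set" where
  "supp n x = {i. i < n \<and> x i \<noteq> 0}"

definition wt :: "nat \<Rightarrow> (nat \<Rightarrow> nat) \<Rightarrow> nat" where
  "wt n x = card (supp n x)"

definition hdist :: "nat \<Rightarrow> (nat \<Rightarrow> nat) \<Rightarrow> (nat \<Rightarrow> nat) \<Rightarrow> nat" where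
  "hdist n x y = card {i. i < n \<and> x i \<noteq> y i}"

definition J :: "nat \<Rightarrow> nat \<Rightarrow> nat \<Rightarrow> (nat \<Rightarrow> nat) set" where
  "J q n w = {x \<in> words q n. wt n x = w}"

definition anticode :: "nat \<Rightarrow> nat \<Rightarrow> (nat \<Rightarrow> nat) set \<Rightarrow> (nat \<Rightarrow> nat) set \<Rightarrow> bool" where
  "anticode n D S A \<longleftrightarrow> A \<noteq> {} \<and> A \<subseteq> S \<and> (\<forall>x\<in>A. \<forall>y\<in>A. hdist n x y \<le> D)"

definition max_anticode :: "nat \<Rightarrow> nat \<Rightarrow> (nat \<Rightarrow> nat) set \<Rightarrow> (nat \<Rightarrow> nat) set \<Rightarrow> bool" where
  "max_anticode n D S A \<longleftrightarrow> anticode n D S A \<and> (\<forall>B. anticode n D S B \<longrightarrow> card B \<le> card A)"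

definition App :: "nat \<Rightarrow> nat \<Rightarrow> nat \<Rightarrow> nat \<Rightarrow> (nat \<Rightarrow> nat) set" where
  "App q n w t = {x \<in> words q n. (\<forall>i<t. x i = 0) \<and> card {i. t \<le> i \<and> i < n \<and> x i \<noteq> 0} = w}"

end

theory Submission
  imports Defs "HOL-Library.FuncSet"
begin

text \<open>
  For large \<open>q\<close> the problem reduces to the Erdos-Ko-Rado theorem with Wilson's exact bound
  \<open>n \<ge> (k - t + 1) (t + 1)\<close>, applied to the zero sets, of size \<open>k = n - w\<close>. Group an anticode by
  supports. If two occurring supports have zero sets meeting in fewer than \<open>t\<close> points, every word on
  the one agrees with every word on the other at a common support coordinate, so each of the
  two groups has at most \<open>w (q - 1)^(w - 1)\<close> words. Hence the supports of larger groups have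
  \<open>t\<close>-intersecting zero sets, and they stay so when any other occurring support is added; such
  a support therefore costs a full group of \<open>(q - 1)^w\<close> words.

  The Erdos-Ko-Rado bound follows the generating set method of Ahlswede and Khachatrian. A
  \<open>t\<close>-intersecting family of subsets of \<open>{..<l}\<close> is weighted by the number of extensions of its
  members to \<open>k\<close>-subsets of \<open>{..<n}\<close>, and the last coordinate is removed without loss of weight
  until \<open>l = t\<close>, where only the full set remains. Take the family closed under supersets and
  under replacing the last element \<open>l\<close> by any other. Call a member \<open>X\<close> containing \<open>l\<close> pivotal if
  \<open>X - {l}\<close> is not a member. Two pivotal sets meeting in exactly \<open>t\<close> points cover \<open>{..l}\<close>, since
  otherwise replacing \<open>l\<close> in one of them by an uncovered point would make the intersection too
  small; so their sizes add up to \<open>l + 1 + t\<close>. Of any two distinct sizes with this sum one is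
  discarded, and among the pivotal sets of size \<open>(l + 1 + t) / 2\<close> only those missing a
  suitable point \<open>m < l\<close> are kept; removing \<open>l\<close> from the pivotal sets that are kept preserves
  \<open>t\<close>-intersection and compensates the loss.
\<close>

section \<open>Intersecting families and shifting\<close>

definition t_intersecting :: "nat \<Rightarrow> 'a set set \<Rightarrow> bool" where
  "t_intersecting t F \<longleftrightarrow> (\<forall>A\<in>F. \<forall>B\<in>F. t \<le> card (A \<inter> B))"

lemma t_intersecting_card: "t_intersecting t F \<Longrightarrow> X \<in> F \<Longrightarrow> t \<le> card X"
  unfolding t_intersecting_def by (metis Int_absorb)

text \<open>The number of \<open>k\<close>-subsets of \<open>{..<n}\<close> whose trace on \<open>{..<l}\<close> is a given set of size \<open>s\<close>. The
  case distinction guards against truncated subtraction in \<open>k - s\<close>.\<close>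

definition ext_count :: "nat \<Rightarrow> nat \<Rightarrow> nat \<Rightarrow> nat \<Rightarrow> nat" where
  "ext_count n k l s = (if s \<le> k then (n - l) choose (k - s) else 0)"

section \<open>Recursion and inequalities for extension counts\<close>

lemma ext_count_Suc:
  assumes "l < n"
  shows "ext_count n k l s = ext_count n k (Suc l) s + ext_count n k (Suc l) (Suc s)"
proof -
  obtain N where N: "n - l = Suc N" "n - Suc l = N" using assms by (metis Suc_diff_Suc)
  show ?thesis
  proof (cases "s < k")
    case True
    then have "k - s = Suc (k - Suc s)" by simp
    with True N show ?thesis by (simp add: ext_count_def)
  next
    case False
    with N show ?thesis by (auto simp: ext_count_def)
  qed
qed

text \<open>With \<open>a = k - i\<close>, \<open>b = k - j\<close> and \<open>N = n - l\<close> the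
  hypotheses give \<open>a + b + 1 \<le> N\<close>. Lowering both sizes multiplies the product of
  binomials by \<open>(N - a) * (N - b) / (Suc a * Suc b)\<close>, at least 1 because
  \<open>Suc a \<le> N - b\<close> and \<open>Suc b \<le> N - a\<close>. A size above
  \<open>k\<close> makes the left side 0.\<close>

lemma ext_count_log_concave:
  assumes "i + j = l + t" "2 * k + 1 \<le> n + t" "l \<le> n" "0 < i" "0 < j"
  shows "ext_count n k l i * ext_count n k l j \<le> ext_count n k l (i - 1) * ext_count n k l (j - 1)"
proof (cases "i \<le> k \<and> j \<le> k")
  case False
  then show ?thesis by (auto simp: ext_count_def)
next
  case True
  define N a b where "N = n - l" and "a = k - i" and "b = k - j"
  have le: "a + b + 1 \<le> N" using True assms unfolding N_def a_def b_def by linarith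
  have ab: "k - (i - 1) = Suc a" "k - (j - 1) = Suc b" using True assms by (auto simp: a_def b_def)
  have *: "Suc c * (N choose Suc c) = (N - c) * (N choose c)" for c
    by (metis Suc_times_binomial_add binomial_absorb_comp binomial_absorption)
  have "(Suc a * Suc b) * ((N choose a) * (N choose b)) \<le> ((N - b) * (N - a)) * ((N choose a) * (N choose b))"
    using le by (intro mult_le_mono) auto
  also have "\<dots> = (Suc a * (N choose Suc a)) * (Suc b * (N choose Suc b))"
    unfolding * by (simp add: mult_ac)
  also have "\<dots> = (Suc a * Suc b) * ((N choose Suc a) * (N choose Suc b))"
    by (simp only: mult_ac)
  finally have "(N choose a) * (N choose b) \<le> (N choose Suc a) * (N choose Suc b)"
    by (simp del: mult_Suc mult_Suc_right)
  then show ?thesis using True ab assms by (auto simp: ext_count_def N_def a_def b_def)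
qed

text \<open>Wilson's bound enters at full strength here. Averaging will keep a fraction
  \<open>(l - i) / (l - 1)\<close> of the pivotal sets of the middle size \<open>i\<close>. With
  \<open>N = n - l\<close> and \<open>a = k - i\<close>, each kept set then counts
  \<open>Suc N choose Suc a\<close> instead of \<open>N choose a\<close>, a gain by the factor
  \<open>Suc N / Suc a\<close>.\<close>

lemma ext_count_middle:
  assumes "2 * i = l + t" "t < l" "0 < t" "t \<le> k" "(k - t + 1) * (t + 1) \<le> n" "l \<le> n"
  shows "(l - 1) * ext_count n k l i \<le> (l - i) * (ext_count n k l (i - 1) + ext_count n k l i)"
proof (cases "i \<le> k")
  case False
  then show ?thesis by (simp add: ext_count_def)
next
  case True
  define r where "r = i - t"
  have i: "i = t + r" and l: "l = t + 2 * r" and r: "0 < r" using assms by (auto simp: r_def)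
  define a where "a = k - i"
  have k: "k = t + r + a" using True i by (simp add: a_def)
  define N where "N = n - l"
  have n: "n = t + 2 * r + N" using assms(6) l by (simp add: N_def)
  obtain r' where r': "r = Suc r'" using r by (cases r) auto
  obtain t' where t': "t = Suc t'" using assms(3) by (cases t) auto
  \<comment> \<open>An equality for \<open>r = 1\<close>. Subtracting
    \<open>r * (t + 2 * r - 1)\<close> from both ends of the chain leaves the inequality between
    \<open>a + 1\<close> and \<open>N + 1\<close>.\<close>
  have "(t + 2 * r - 1) * (a + 1 + r) \<le> r * (t + 1) * (a + 1 + r)"
    by (rule mult_right_mono) (auto simp: r' t')
  also have "\<dots> = r * ((k - t + 1) * (t + 1))" by (simp add: k algebra_simps)
  also have "\<dots> \<le> r * n" using assms(5) by (rule mult_left_mono) simp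
  finally have "(t + 2 * r - 1) * (a + 1) \<le> r * (N + 1)"
    by (simp add: n t' algebra_simps)
  then have main: "(l - 1) * Suc a \<le> (l - i) * Suc N" by (simp add: l i)
  have c: "ext_count n k l (i - 1) + ext_count n k l i = Suc N choose Suc a"
    using True i r assms by (auto simp: ext_count_def N_def a_def Suc_diff_le)
  have "Suc a * ((l - 1) * (N choose a)) = (l - 1) * Suc a * (N choose a)" by (simp only: mult_ac)
  also have "\<dots> \<le> (l - i) * Suc N * (N choose a)" using main by (rule mult_right_mono) simp
  also have "\<dots> = (l - i) * (Suc a * (Suc N choose Suc a))"
    by (simp only: Suc_times_binomial mult.assoc)
  also have "\<dots> = Suc a * ((l - i) * (Suc N choose Suc a))" by (simp only: mult_ac)
  finally have "(l - 1) * (N choose a) \<le> (l - i) * (Suc N choose Suc a)"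
    by (simp del: mult_Suc mult_Suc_right binomial_Suc_Suc)
  then show ?thesis using True unfolding c by (simp add: ext_count_def N_def a_def)
qed

section \<open>Shifting: the Erdos-Ko-Rado compression from \<open>l\<close> to
  \<open>m\<close>\<close>

definition shift :: "'a \<Rightarrow> 'a \<Rightarrow> 'a set set \<Rightarrow> 'a set \<Rightarrow> 'a set" where
  "shift m l G X = (if l \<in> X \<and> m \<notin> X \<and> insert m (X - {l}) \<notin> G then insert m (X - {l}) else X)"

lemma card_shift: "finite X \<Longrightarrow> card (shift m l G X) = card X"
  using card_Suc_Diff1[of X l] by (auto simp: shift_def)

lemma inj_on_shift: "inj_on (shift m l G) G"
  unfolding inj_on_def shift_def by (auto split: if_splits)

lemma card_swap_Int:
  assumes "finite X" "l \<in> X" "m \<notin> X" "l \<in> Y" "m \<in> Y"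
  shows "card (insert m (X - {l}) \<inter> Y) = card (X \<inter> Y)"
proof -
  have "insert m (X - {l}) \<inter> Y = insert m (X \<inter> Y - {l})" using assms by auto
  then show ?thesis using assms card_Suc_Diff1[of "X \<inter> Y" l] by simp
qed

text \<open>Two moved sets trade \<open>l\<close> for \<open>m\<close> together. For a moved
  \<open>X\<close> and an unmoved \<open>Y\<close> the critical case is \<open>l\<close> in
  \<open>Y\<close>, \<open>m\<close> not in \<open>Y\<close>: then \<open>Y\<close> stayed only
  because its own swap lies in \<open>G\<close>, and this swap meets \<open>X\<close> exactly where
  \<open>Y\<close> meets the moved \<open>X\<close>.\<close>

lemma t_intersecting_shift:
  assumes "t_intersecting t G" "\<And>X. X \<in> G \<Longrightarrow> finite X" "m \<noteq> l"
  shows "t_intersecting t (shift m l G ` G)"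
proof -
  have t: "t \<le> card (X \<inter> Y)" if "X \<in> G" "Y \<in> G" for X Y
    using assms that by (auto simp: t_intersecting_def)
  let ?s = "\<lambda>X. insert m (X - {l})"
  let ?mv = "\<lambda>X. l \<in> X \<and> m \<notin> X \<and> ?s X \<notin> G"
  have one: "t \<le> card (?s X \<inter> Y)" if XY: "X \<in> G" "Y \<in> G" "?mv X" "\<not> ?mv Y" for X Y
  proof -
    consider "l \<notin> Y" | "l \<in> Y" "m \<in> Y" | "l \<in> Y" "m \<notin> Y" "?s Y \<in> G" using XY by blast
    then show ?thesis
    proof cases
      case 1
      have "card (X \<inter> Y) \<le> card (?s X \<inter> Y)" using 1 assms(2)[OF XY(2)] by (intro card_mono) auto
      with t[OF XY(1,2)] show ?thesis by simp
    next
      case 2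
      then have "card (?s X \<inter> Y) = card (X \<inter> Y)"
        using XY assms(2) by (intro card_swap_Int) auto
      then show ?thesis using t[OF XY(1,2)] by simp
    next
      case 3
      have "?s X \<inter> Y = X \<inter> ?s Y" using 3 XY by auto
      then show ?thesis using t[OF XY(1) 3(3)] by simp
    qed
  qed
  have two: "t \<le> card (?s X \<inter> ?s Y)" if XY: "X \<in> G" "Y \<in> G" "?mv X" "?mv Y" for X Y
  proof -
    have "?s X \<inter> ?s Y = insert m (X \<inter> Y - {l})" by auto
    moreover have "card \<dots> = card (X \<inter> Y)"
      using XY assms(2)[OF XY(1)] card_Suc_Diff1[of "X \<inter> Y" l] by simp
    ultimately show ?thesis using t[OF XY(1,2)] by simp
  qed
  have "t \<le> card (shift m l G X \<inter> shift m l G Y)" if XY: "X \<in> G" "Y \<in> G" for X Y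
  proof -
    have mv: "?mv Z \<Longrightarrow> shift m l G Z = ?s Z" "\<not> ?mv Z \<Longrightarrow> shift m l G Z = Z" for Z
      by (auto simp: shift_def)
    consider "?mv X" "?mv Y" | "?mv X" "\<not> ?mv Y" | "\<not> ?mv X" "?mv Y" | "\<not> ?mv X" "\<not> ?mv Y" by blast
    then show ?thesis
    proof cases
      case 1
      show ?thesis unfolding mv(1)[OF 1(1)] mv(1)[OF 1(2)] by (rule two[OF XY 1])
    next
      case 2
      show ?thesis unfolding mv(1)[OF 2(1)] mv(2)[OF 2(2)] by (rule one[OF XY 2])
    next
      case 3
      show ?thesis unfolding mv(2)[OF 3(1)] mv(1)[OF 3(2)] Int_commute[of X] by (rule one[OF XY(2,1) 3(2,1)])
    next
      case 4
      show ?thesis unfolding mv(2)[OF 4(1)] mv(2)[OF 4(2)] by (rule t[OF XY])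
    qed
  qed
  then show ?thesis by (auto simp: t_intersecting_def)
qed

lemma obtain_stable_family:
  fixes f :: "nat \<Rightarrow> nat" and E :: "'a set"
  assumes "finite E" "G \<subseteq> Pow E" "t_intersecting t G" "l \<in> E"
  obtains H where "H \<subseteq> Pow E" "t_intersecting t H"
    "(\<Sum>X\<in>G. f (card X)) \<le> (\<Sum>X\<in>H. f (card X))"
    "\<And>X Y. X \<in> H \<Longrightarrow> X \<subseteq> Y \<Longrightarrow> Y \<subseteq> E \<Longrightarrow> Y \<in> H"
    "\<And>X m. X \<in> H \<Longrightarrow> l \<in> X \<Longrightarrow> m \<in> E \<Longrightarrow> m \<notin> X \<Longrightarrow> insert m (X - {l}) \<in> H"
proof -
  define F where "F = (\<lambda>H::'a set set. \<Sum>X\<in>H. f (card X))"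
  define C where "C = {H. H \<subseteq> Pow E \<and> t_intersecting t H \<and> F G \<le> F H}"
  \<comment> \<open>Adding a set and moving a set off \<open>l\<close> both increase this potential, so a maximiser is
    closed under both.\<close>
  define p where "p = (\<lambda>X. if l \<in> X then 1 else 2 :: nat)"
  have "finite C" using assms(1) by (auto simp: C_def intro: finite_subset[of _ "Pow (Pow E)"])
  have "C \<noteq> {}" using assms by (auto simp: C_def)
  then obtain H where H: "H \<in> C" "sum p H = Max (sum p ` C)"
    using Max_in[of "sum p ` C"] \<open>finite C\<close> by fastforce
  have max: "sum p K \<le> sum p H" if "K \<in> C" for K
    unfolding H(2) using that \<open>finite C\<close> by (intro Max_ge) auto
  have HE: "H \<subseteq> Pow E" and Ht: "t_intersecting t H" and HF: "F G \<le> F H" using H(1) by (auto simp: C_def)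
  have fin: "finite X" if "X \<in> H" for X using that HE assms(1) by (auto intro: finite_subset)
  have finH: "finite H" using HE assms(1) by (auto intro: finite_subset)
  have up: "Y \<in> H" if XY: "X \<in> H" "X \<subseteq> Y" "Y \<subseteq> E" for X Y
  proof (rule ccontr)
    assume "Y \<notin> H"
    have finY: "finite Y" using XY assms(1) by (auto intro: finite_subset)
    have XZ: "t \<le> card (X \<inter> Z)" if "Z \<in> H" for Z using Ht XY that by (auto simp: t_intersecting_def)
    have YZ: "t \<le> card (Y \<inter> Z)" if "Z \<in> H" for Z
      using XZ[OF that] card_mono[of "Y \<inter> Z" "X \<inter> Z"] XY(2) finY by fastforce
    have "t \<le> card Y" using XZ[OF XY(1)] card_mono[OF finY XY(2)] by simp
    then have "t_intersecting t (insert Y H)"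
      using YZ Ht by (auto simp: t_intersecting_def Int_commute)
    moreover have "F H \<le> F (insert Y H)" unfolding F_def by (rule sum_mono2) (use finH in auto)
    ultimately have "insert Y H \<in> C" using HE HF XY by (auto simp: C_def)
    from max[OF this] show False using finH \<open>Y \<notin> H\<close> by (simp add: p_def split: if_splits)
  qed
  have cmp: "insert m (X - {l}) \<in> H" if X: "X \<in> H" "l \<in> X" "m \<in> E" "m \<notin> X" for X m
  proof (rule ccontr)
    assume new: "insert m (X - {l}) \<notin> H"
    let ?s = "shift m l H"
    have ml: "m \<noteq> l" using X by auto
    have "F (?s ` H) = F H" unfolding F_def using fin
      by (subst sum.reindex) (auto simp: inj_on_shift card_shift)
    moreover have "?s ` H \<subseteq> Pow E" 
    unfolding shift_def using HE X by (auto split: if_splits)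
    ultimately have "?s ` H \<in> C"
      using HF t_intersecting_shift[OF Ht fin ml] by (auto simp: C_def)
    from max[OF this] have "(\<Sum>X\<in>H. p (?s X)) \<le> sum p H"
      by (simp add: sum.reindex inj_on_shift)
    \<comment> \<open>No shifted set gains \<open>l\<close>, and \<open>X\<close> itself loses it
      because its swap is not in \<open>H\<close>.\<close>
    moreover have "sum p H < (\<Sum>X\<in>H. p (?s X))"
      using finH X ml new 
      by (intro sum_strict_mono_ex1) (auto simp: p_def shift_def intro!: bexI[of _ X])
    ultimately show False by simp
  qed
  show thesis using that HE Ht HF up cmp unfolding F_def by blast
qed

section \<open>The Erdos-Ko-Rado theorem with Wilson's bound\<close>

lemma exists_often_missed_element:
  fixes M :: "nat set set"
  assumes "0 < l" "finite M" "\<And>X. X \<in> M \<Longrightarrow> X \<subseteq> {..l} \<and> l \<in> X \<and> card X = i"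
  shows "\<exists>m<l. (Suc l - i) * card M \<le> l * card {X \<in> M. m \<notin> X}"
proof (rule ccontr)
  assume "\<not> ?thesis"
  then have less: "l * card {X \<in> M. m \<notin> X} < (Suc l - i) * card M" if "m < l" for m
    using \<open>m < l\<close> by (metis not_less)
  \<comment> \<open>Double counting: since \<open>X\<close> contains \<open>l\<close>, all
    \<open>Suc l - i\<close> points it misses lie below \<open>l\<close>.\<close>
  have "card {m \<in> {..<l}. m \<notin> X} = Suc l - i" if "X \<in> M" for X
  proof -
    have X: "X \<subseteq> {..l}" "l \<in> X" "card X = i" using assms(3)[OF that] by auto
    have "{m \<in> {..<l}. m \<notin> X} = {..l} - X" using X by (auto simp: le_less)
    then show ?thesis using X finite_subset[OF X(1)] by (simp add: card_Diff_subset)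
  qed
  then have "(\<Sum>m\<in>{..<l}. card {X \<in> M. m \<notin> X}) = (\<Sum>X\<in>M. Suc l - i)"
    using assms(2) by (intro sum_multicount_gen) auto
  then have "(\<Sum>m<l. l * card {X \<in> M. m \<notin> X}) = (\<Sum>m<l. (Suc l - i) * card M)"
    by (simp add: sum_distrib_left[symmetric])
  moreover have "(\<Sum>m<l. l * card {X \<in> M. m \<notin> X}) < (\<Sum>m<l. (Suc l - i) * card M)"
    using less assms(1) by (intro sum_strict_mono) auto
  ultimately show False by simp
qed

lemma sum_by_card:
  assumes "finite R" "finite A"
  shows "(\<Sum>X | X \<in> R \<and> card X \<in> A. g (card X)) = (\<Sum>i\<in>A. card {X \<in> R. card X = i} * (g i :: nat))"
proof -
  have "(\<Sum>X | X \<in> R \<and> card X \<in> A. g (card X))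
      = (\<Sum>i\<in>A. \<Sum>X | X \<in> {X \<in> R. card X \<in> A} \<and> card X = i. g (card X))"
    using assms by (intro sum.group[symmetric]) auto
  also have "\<dots> = (\<Sum>i\<in>A. \<Sum>X | X \<in> R \<and> card X = i. g i)"
    by (intro sum.cong) auto
  finally show ?thesis by simp
qed

text \<open>In the application \<open>r i\<close> counts the pivotal sets of size \<open>i\<close>,
  and \<open>w (i - 1) + w i\<close> is the weight of such a set after its last element is removed
  and the last coordinate forgotten.\<close>

lemma select_one_of_complementary_sizes:
  fixes r w :: "nat \<Rightarrow> nat"
  assumes "0 < t"
    and log: "\<And>i j. i + j = L + t \<Longrightarrow> 0 < i \<Longrightarrow> 0 < j \<Longrightarrow> w i * w j \<le> w (i - 1) * w (j - 1)"
  shows "\<exists>I \<subseteq> {i \<in> {t..L}. 2 * i \<noteq> L + t}. (\<forall>i\<in>I. \<forall>j\<in>I. i + j \<noteq> L + t) \<and>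
    (\<Sum>i | i \<in> {t..L} \<and> 2 * i \<noteq> L + t. r i * w i) \<le> (\<Sum>i\<in>I. r i * (w (i - 1) + w i))"
proof -
  \<comment> \<open>Keep size \<open>i\<close> if moving all its sets down pays for discarding the sets of size \<open>\<sigma> i\<close>; by the
    product inequality this is the case for \<open>i\<close> or for \<open>\<sigma> i\<close>.\<close>
  define \<sigma> where "\<sigma> = (\<lambda>i. L + t - i)"
  define c where "c = (\<lambda>i. r (\<sigma> i) * w (\<sigma> i) \<le> r i * w (i - 1))"
  define N where "N = {i \<in> {t..L}. 2 * i \<noteq> L + t}"
  \<comment> \<open>If both sizes of a pair pass the test, the smaller one is kept.\<close>
  define I where "I = {i \<in> N. c i \<and> (\<not> c (\<sigma> i) \<or> i < \<sigma> i)}"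
  have \<sigma>: "\<sigma> i \<in> N" "\<sigma> (\<sigma> i) = i" "\<sigma> i \<noteq> i" "i + \<sigma> i = L + t" if "i \<in> N" for i
    using that by (auto simp: N_def \<sigma>_def)
  have c_or: "c i \<or> c (\<sigma> i)" if i: "i \<in> N" for i
  proof (rule ccontr)
    assume "\<not> ?thesis"
    then have "r i * w (i - 1) < r (\<sigma> i) * w (\<sigma> i)" "r (\<sigma> i) * w (\<sigma> i - 1) < r i * w i"
      using \<sigma>[OF i] by (auto simp: c_def not_le)
    then have "(r i * w (i - 1)) * (r (\<sigma> i) * w (\<sigma> i - 1)) < (r (\<sigma> i) * w (\<sigma> i)) * (r i * w i)"
      by (rule mult_strict_mono') simp_all
    also have "\<dots> = r i * r (\<sigma> i) * (w i * w (\<sigma> i))" by (simp add: mult_ac)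
    also have "\<dots> \<le> r i * r (\<sigma> i) * (w (i - 1) * w (\<sigma> i - 1))"
    proof (intro mult_left_mono log)
      show "i + \<sigma> i = L + t" "0 < i" "0 < \<sigma> i"
        using \<sigma>[OF i] i assms(1) by (auto simp: N_def)
    qed simp
    finally show False by (simp add: mult_ac)
  qed
  have disj: "\<sigma> i \<notin> I" if "i \<in> I" for i
    using that \<sigma>(2)[of i] by (auto simp: I_def)
  have fin: "finite I" by (simp add: I_def N_def)
  have inj: "inj_on \<sigma> I" by (rule inj_on_inverseI[of _ \<sigma>]) (simp add: I_def \<sigma>)
  have IN: "I \<subseteq> N" by (auto simp: I_def)
  have "i \<in> I \<or> \<sigma> i \<in> I" if "i \<in> N" for i
    using c_or[OF that] \<sigma>[OF that] that by (auto simp: I_def)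
  then have "N \<subseteq> I \<union> \<sigma> ` I" using \<sigma>(2) by (metis UnCI image_eqI subsetI)
  then have N: "N = I \<union> \<sigma> ` I" using IN \<sigma>(1) by blast
  have "(\<Sum>i\<in>N. r i * w i) = (\<Sum>i\<in>I. r i * w i) + (\<Sum>i\<in>\<sigma> ` I. r i * w i)"
    unfolding N by (rule sum.union_disjoint) (use fin disj in auto)
  also have "\<dots> = (\<Sum>i\<in>I. r i * w i + r (\<sigma> i) * w (\<sigma> i))"
    by (simp add: sum.reindex[OF inj] sum.distrib)
  also have "\<dots> \<le> (\<Sum>i\<in>I. r i * (w (i - 1) + w i))"
    by (rule sum_mono) (auto simp: I_def c_def algebra_simps)
  finally have le: "(\<Sum>i\<in>N. r i * w i) \<le> (\<Sum>i\<in>I. r i * (w (i - 1) + w i))" .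
  have ne: "i + j \<noteq> L + t" if "i \<in> I" "j \<in> I" for i j
  proof
    assume "i + j = L + t"
    then have "j = \<sigma> i" unfolding \<sigma>_def by linarith
    with that disj show False by simp
  qed
  show ?thesis using ne IN le unfolding N_def by blast
qed

text \<open>Deleting \<open>l\<close> will cost each intersection one point, hence
  \<open>Suc t\<close>. A pair meeting in only \<open>t\<close> points has complementary sizes and
  union \<open>{..l}\<close>; the selection rules out the former for unequal sizes and the latter
  for the middle size.\<close>

lemma select_pivotal_sets:
  fixes R :: "nat set set" and w :: "nat \<Rightarrow> nat"
  assumes "0 < t" "t \<le> l"
    and R: "\<And>X. X \<in> R \<Longrightarrow> X \<subseteq> {..l} \<and> l \<in> X"
    and t: "t_intersecting t R"
    and cover: "\<And>X Y. X \<in> R \<Longrightarrow> Y \<in> R \<Longrightarrow> card (X \<inter> Y) = t \<Longrightarrow> X \<union> Y = {..l}"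
    and log: "\<And>i j. i + j = Suc l + t \<Longrightarrow> 0 < i \<Longrightarrow> 0 < j \<Longrightarrow> w i * w j \<le> w (i - 1) * w (j - 1)"
    and mid: "\<And>i. 2 * i = Suc l + t \<Longrightarrow> l * w i \<le> (Suc l - i) * (w (i - 1) + w i)"
  shows "\<exists>R'\<subseteq>R. t_intersecting (Suc t) R' \<and>
    (\<Sum>X\<in>R. w (card X)) \<le> (\<Sum>X\<in>R'. w (card X - 1) + w (card X))"
proof -
  have finX: "finite X" if "X \<in> R" for X using R[OF that] finite_subset by blast
  have "R \<subseteq> Pow {..l}" using R by auto
  then have finR: "finite R" by (rule finite_subset) simp
  have size: "t \<le> card X" "card X \<le> Suc l" if "X \<in> R" for X
  proof -
    show "t \<le> card X" using t that by (rule t_intersecting_card)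
    show "card X \<le> Suc l" using card_mono[of "{..l}" X] R[OF that] by simp
  qed
  have big: "Suc t \<le> card (X \<inter> Y)" if XY: "X \<in> R" "Y \<in> R"
    and "card X + card Y \<noteq> Suc l + t \<or> X \<union> Y \<noteq> {..l}" for X Y
  proof (rule ccontr)
    assume "\<not> ?thesis"
    moreover have "t \<le> card (X \<inter> Y)" using t XY by (simp add: t_intersecting_def)
    ultimately have ct: "card (X \<inter> Y) = t" by simp
    from cover[OF XY this] have "X \<union> Y = {..l}" .
    with card_Un_Int[OF finX[OF XY(1)] finX[OF XY(2)]] ct that(3) show False by simp
  qed
  define N where "N = {i \<in> {t..Suc l}. 2 * i \<noteq> Suc l + t}"
  define M where "M = {X \<in> R. 2 * card X = Suc l + t}"
  obtain I where I: "I \<subseteq> N" "\<And>i j. i \<in> I \<Longrightarrow> j \<in> I \<Longrightarrow> i + j \<noteq> Suc l + t"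
    "(\<Sum>i\<in>N. card {X \<in> R. card X = i} * w i)
       \<le> (\<Sum>i\<in>I. card {X \<in> R. card X = i} * (w (i - 1) + w i))"
    using select_one_of_complementary_sizes[where r = "\<lambda>i. card {X \<in> R. card X = i}" and L = "Suc l" and w = w and t = t,
          OF assms(1) log]
    unfolding N_def[symmetric] by auto
  have finN: "finite N" by (simp add: N_def)
  have finI: "finite I" using I(1) by (rule finite_subset) (simp add: N_def)
  \<comment> \<open>If \<open>Suc l + t\<close> is odd, \<open>M\<close> is empty and the rounding
    does no harm.\<close>
  define i where "i = (Suc l + t) div 2"
  have Mi: "card X = i" if "X \<in> M" for X
  proof -
    from that have "2 * card X = Suc l + t" by (simp add: M_def)
    then show ?thesis unfolding i_def by linarith
  qed
  have finM: "finite M" using finR by (simp add: M_def)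
  have "\<exists>m<l. (Suc l - i) * card M \<le> l * card {X \<in> M. m \<notin> X}"
  proof (rule exists_often_missed_element[OF _ finM])
    show "X \<subseteq> {..l} \<and> l \<in> X \<and> card X = i" if "X \<in> M" for X
      using R[of X] Mi[OF that] that by (simp add: M_def)
    show "0 < l" using assms(1,2) by linarith
  qed
  then obtain m where m: "m < l" "(Suc l - i) * card M \<le> l * card {X \<in> M. m \<notin> X}" by blast
  have sumM: "(\<Sum>X\<in>M. w (card X)) \<le> (\<Sum>X | X \<in> M \<and> m \<notin> X. w (card X - 1) + w (card X))"
  proof (cases "M = {}")
    case False
    then obtain X where X: "X \<in> M" by blast
    then have i2: "2 * i = Suc l + t" unfolding Mi[OF X, symmetric] by (simp add: M_def)
    have "l * (card M * w i) = card M * (l * w i)" by simp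
    also have "\<dots> \<le> card M * ((Suc l - i) * (w (i - 1) + w i))"
      using mid[OF i2] by (rule mult_left_mono) simp
    also have "\<dots> = (Suc l - i) * card M * (w (i - 1) + w i)" by (simp only: mult_ac)
    also have "\<dots> \<le> l * card {X \<in> M. m \<notin> X} * (w (i - 1) + w i)"
      using m(2) by (rule mult_right_mono) simp
    finally have "card M * w i \<le> card {X \<in> M. m \<notin> X} * (w (i - 1) + w i)"
      using assms(1,2) by (simp add: mult.assoc)
    then show ?thesis using Mi by simp
  qed simp
  define R1 where "R1 = {X \<in> R. card X \<in> I}"
  define R' where "R' = R1 \<union> {X \<in> M. m \<notin> X}"
  have "R = {X \<in> R. card X \<in> N} \<union> M" using size by (auto simp: N_def M_def)
  then have "(\<Sum>X\<in>R. w (card X)) = (\<Sum>X\<in>{X \<in> R. card X \<in> N} \<union> M. w (card X))" by simp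
  also have "\<dots> = (\<Sum>X | X \<in> R \<and> card X \<in> N. w (card X)) + (\<Sum>X\<in>M. w (card X))"
    by (rule sum.union_disjoint) (use finR in \<open>auto simp: N_def M_def\<close>)
  also have "(\<Sum>X | X \<in> R \<and> card X \<in> N. w (card X)) \<le> (\<Sum>X\<in>R1. w (card X - 1) + w (card X))"
    unfolding R1_def sum_by_card[OF finR finN] sum_by_card[OF finR finI, where g = "\<lambda>i. w (i - 1) + w i"]
    by (rule I(3))
  also note sumM
  also have "(\<Sum>X\<in>R1. w (card X - 1) + w (card X)) + (\<Sum>X | X \<in> M \<and> m \<notin> X. w (card X - 1) + w (card X))
      = (\<Sum>X\<in>R'. w (card X - 1) + w (card X))"
    unfolding R'_def by (rule sum.union_disjoint[symmetric])
      (use finR I(1) in \<open>auto simp: N_def M_def R1_def\<close>)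
  finally have le: "(\<Sum>X\<in>R. w (card X)) \<le> (\<Sum>X\<in>R'. w (card X - 1) + w (card X))" by simp
  \<comment> \<open>Two sizes in \<open>I\<close> are not complementary; the middle size is
    complementary only to itself and is not in \<open>I\<close>; two kept sets from \<open>M\<close>
    both miss \<open>m\<close>.\<close>
  have "card X + card Y \<noteq> Suc l + t \<or> X \<union> Y \<noteq> {..l}" if "X \<in> R'" "Y \<in> R'" for X Y
  proof -
    have mid_I: "j + k \<noteq> Suc l + t" if "j \<in> I" "2 * k = Suc l + t" for j k
      using that I(1) by (auto simp: N_def)
    show ?thesis
      using that I(2) mid_I[of "card X" "card Y"] mid_I[of "card Y" "card X"] m(1)
      by (auto simp: R'_def R1_def M_def add.commute)
  qed
  then have "t_intersecting (Suc t) R'"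
    unfolding t_intersecting_def using big by (auto simp: R'_def R1_def M_def)
  moreover have "R' \<subseteq> R" by (auto simp: R'_def R1_def M_def)
  ultimately show ?thesis using le by blast
qed

section \<open>Forgetting the last coordinate, and the induction on \<open>l\<close>\<close>

lemma restrict_last_coordinate:
  assumes "0 < t" "t \<le> l" "l < n" "t \<le> k" "(k - t + 1) * (t + 1) \<le> n"
    and "G \<subseteq> Pow {..<Suc l}" "t_intersecting t G"
  obtains K where "K \<subseteq> Pow {..<l}" "t_intersecting t K"
    "(\<Sum>X\<in>G. ext_count n k (Suc l) (card X)) \<le> (\<Sum>X\<in>K. ext_count n k l (card X))"
proof -
  define w where "w = ext_count n k (Suc l)"
  define E where "E = {..l}"
  have E_eq: "E = insert l {..<l}" by (auto simp: E_def)
  have GE: "G \<subseteq> Pow E" using assms(6) by (simp add: E_def lessThan_Suc_atMost)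
  obtain H where H: "H \<subseteq> Pow E" "t_intersecting t H"
    "(\<Sum>X\<in>G. w (card X)) \<le> (\<Sum>X\<in>H. w (card X))"
    and up: "\<And>X Y. X \<in> H \<Longrightarrow> X \<subseteq> Y \<Longrightarrow> Y \<subseteq> E \<Longrightarrow> Y \<in> H"
    and cmp: "\<And>X m. X \<in> H \<Longrightarrow> l \<in> X \<Longrightarrow> m \<in> E \<Longrightarrow> m \<notin> X \<Longrightarrow> insert m (X - {l}) \<in> H"
    using obtain_stable_family[OF _ GE assms(7), of l w] by (auto simp: E_def)
  have finX: "finite X" if "X \<in> H" for X
    using that H(1) by (auto simp: E_def intro: finite_subset)
  have finH: "finite H" using H(1) by (rule finite_subset) (simp add: E_def)
  have tH: "t \<le> card (X \<inter> Y)" if "X \<in> H" "Y \<in> H" for X Y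
    using H(2) that by (simp add: t_intersecting_def)
  \<comment> \<open>The sets that must be altered when the coordinate \<open>l\<close> is forgotten.\<close>
  define R where "R = {X \<in> H. l \<in> X \<and> X - {l} \<notin> H}"
  have cover: "X \<union> Y = {..l}" if XY: "X \<in> R" "Y \<in> R" "card (X \<inter> Y) = t" for X Y
  proof (rule ccontr)
    assume "X \<union> Y \<noteq> {..l}"
    moreover have "X \<union> Y \<subseteq> {..l}" using XY H(1) by (auto simp: R_def E_def)
    ultimately obtain m where m: "m \<in> E" "m \<notin> X" "m \<notin> Y" by (auto simp: E_def)
    have "insert m (X - {l}) \<in> H" using cmp[OF _ _ m(1,2)] XY by (simp add: R_def)
    then have "t \<le> card (insert m (X - {l}) \<inter> Y)" using tH XY by (simp add: R_def)
    also have "insert m (X - {l}) \<inter> Y = (X \<inter> Y) - {l}" using m by auto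
    also have "card \<dots> < card (X \<inter> Y)"
      using XY finX by (intro card_Diff1_less) (auto simp: R_def)
    finally show False using XY(3) by simp
  qed
  \<comment> \<open>For positive \<open>t\<close> Wilson's bound implies the linear bound that the
    product inequality requires.\<close>
  have kn: "2 * k + 1 \<le> n + t"
  proof -
    obtain a where a: "k = t + a" using assms(4) le_Suc_ex by blast
    obtain s where s: "t = Suc s" using assms(1) by (cases t) auto
    show ?thesis using assms(5) by (simp add: a s)
  qed
  have "\<exists>R'\<subseteq>R. t_intersecting (Suc t) R' \<and>
    (\<Sum>X\<in>R. w (card X)) \<le> (\<Sum>X\<in>R'. w (card X - 1) + w (card X))"
  proof (rule select_pivotal_sets[OF assms(1,2), of R w])
    show "X \<subseteq> {..l} \<and> l \<in> X" if "X \<in> R" for X using that H(1) by (auto simp: R_def E_def)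
    show "t_intersecting t R" using tH by (simp add: t_intersecting_def R_def)
    show "w i * w j \<le> w (i - 1) * w (j - 1)" if "i + j = Suc l + t" "0 < i" "0 < j" for i j
      unfolding w_def using ext_count_log_concave[OF that(1) kn _ that(2,3)] assms(3) by simp
    show "l * w i \<le> (Suc l - i) * (w (i - 1) + w i)" if "2 * i = Suc l + t" for i
      using ext_count_middle[OF that _ assms(1,4,5)] assms(2,3) by (simp add: w_def)
  qed (rule cover)
  then obtain R' where R': "R' \<subseteq> R" "t_intersecting (Suc t) R'"
    "(\<Sum>X\<in>R. w (card X)) \<le> (\<Sum>X\<in>R'. w (card X - 1) + w (card X))" by blast
  \<comment> \<open>The nonpivotal sets form pairs \<open>X\<close>, \<open>insert l X\<close> with
    \<open>X\<close> in \<open>K0\<close>; by Pascal's rule such a pair weighs as much as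
    \<open>X\<close> alone on \<open>{..<l}\<close>. Only the pivotal sets lack a partner.\<close>
  define K0 where "K0 = {X \<in> H. l \<notin> X}"
  define K1 where "K1 = (\<lambda>X. X - {l}) ` R'"
  have K0E: "K0 \<subseteq> Pow {..<l}" using H(1) unfolding E_eq K0_def by blast
  have K1E: "K1 \<subseteq> Pow {..<l}" using H(1) R'(1) unfolding E_eq K1_def R_def by blast
  have finR': "finite R'" "finite R" using R'(1) finH by (auto simp: R_def intro: finite_subset)
  have RH: "X \<in> H" "l \<in> X" "X - {l} \<notin> H" if "X \<in> R'" for X using R'(1) that by (auto simp: R_def)
  have inj: "inj_on (\<lambda>X. X - {l}) R'" using RH(2) by (auto simp: inj_on_def)
  have "t_intersecting t (K0 \<union> K1)"
  proof -
    have 1: "t \<le> card ((X - {l}) \<inter> Z)" if "X \<in> R'" "Z \<in> K0" for X Z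
    proof -
      have "(X - {l}) \<inter> Z = X \<inter> Z" using that by (auto simp: K0_def)
      then show ?thesis using tH[of X Z] that RH(1) by (simp add: K0_def)
    qed
    have 2: "t \<le> card ((X - {l}) \<inter> (Y - {l}))" if "X \<in> R'" "Y \<in> R'" for X Y
    proof -
      have "(X - {l}) \<inter> (Y - {l}) = X \<inter> Y - {l}" by auto
      moreover have "Suc t \<le> card (X \<inter> Y)" using R'(2) that by (simp add: t_intersecting_def)
      ultimately show ?thesis using that RH(2) by simp
    qed
    have 3: "t \<le> card (X \<inter> Y)" if "X \<in> K0" "Y \<in> K0" for X Y using tH that by (simp add: K0_def)
    show ?thesis
      using 1 2 3 unfolding t_intersecting_def K1_def by (auto simp: Int_commute)
  qed
  moreover have "(\<Sum>X\<in>H. w (card X)) \<le> (\<Sum>X\<in>K0 \<union> K1. ext_count n k l (card X))"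
  proof -
    have w: "ext_count n k l s = w s + w (Suc s)" for s
      using ext_count_Suc[OF assms(3)] by (simp add: w_def)
    \<comment> \<open>Closure under supersets puts \<open>insert l X\<close> into \<open>H\<close>
      for each \<open>X\<close> in \<open>K0\<close>.\<close>
    have H_split: "H = K0 \<union> (insert l ` K0 \<union> R)"
    proof
      show "H \<subseteq> K0 \<union> (insert l ` K0 \<union> R)"
      proof
        fix X assume X: "X \<in> H"
        show "X \<in> K0 \<union> (insert l ` K0 \<union> R)"
        proof (cases "l \<in> X \<and> X - {l} \<in> H")
          case True
          then have "X = insert l (X - {l})" "X - {l} \<in> K0" by (auto simp: K0_def)
          then show ?thesis by blast
        qed (use X in \<open>auto simp: K0_def R_def\<close>)
      qed
      show "K0 \<union> (insert l ` K0 \<union> R) \<subseteq> H"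
        using up[of _ "insert l _"] H(1) by (fastforce simp: K0_def R_def E_def)
    qed
    have finK0: "finite K0" using finH by (simp add: K0_def)
    have inj0: "inj_on (insert l) K0" 
      by (rule inj_on_inverseI[of _ "\<lambda>X. X - {l}"]) (simp add: K0_def)
    have "(\<Sum>X\<in>H. w (card X)) = (\<Sum>X\<in>K0. w (card X)) + (\<Sum>X\<in>insert l ` K0 \<union> R. w (card X))"
      by (subst H_split, rule sum.union_disjoint) (use finK0 finR' in \<open>auto simp: K0_def R_def\<close>)
    also have "(\<Sum>X\<in>insert l ` K0 \<union> R. w (card X)) = (\<Sum>X\<in>insert l ` K0. w (card X)) + (\<Sum>X\<in>R. w (card X))"
      by (rule sum.union_disjoint) (use finK0 finR' in \<open>auto simp: K0_def R_def\<close>)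
    also have "(\<Sum>X\<in>insert l ` K0. w (card X)) = (\<Sum>X\<in>K0. w (Suc (card X)))"
      unfolding sum.reindex[OF inj0] using finX by (intro sum.cong) (auto simp: K0_def)
    also note R'(3)
    also have "(\<Sum>X\<in>R'. w (card X - 1) + w (card X)) = (\<Sum>X\<in>K1. ext_count n k l (card X))"
      unfolding K1_def sum.reindex[OF inj]
    proof (intro sum.cong refl)
      fix X assume "X \<in> R'"
      then have "Suc (card (X - {l})) = card X" using RH finX by (intro card_Suc_Diff1) auto
      then show "w (card X - 1) + w (card X) = ((\<lambda>X. ext_count n k l (card X)) \<circ> (\<lambda>X. X - {l})) X"
        unfolding o_def w by (metis diff_Suc_1)
    qed
    also have "(\<Sum>X\<in>K0. w (card X)) + ((\<Sum>X\<in>K0. w (Suc (card X))) + (\<Sum>X\<in>K1. ext_count n k l (card X)))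
        = (\<Sum>X\<in>K0. ext_count n k l (card X)) + (\<Sum>X\<in>K1. ext_count n k l (card X))"
      by (simp add: w sum.distrib)
    \<comment> \<open>A pivotal set without \<open>l\<close> is not in \<open>H\<close>, hence not
      in \<open>K0\<close>.\<close>
    also have "\<dots> = (\<Sum>X\<in>K0 \<union> K1. ext_count n k l (card X))"
      by (rule sum.union_disjoint[symmetric])
        (use finK0 finR' RH(3) in \<open>auto simp: K1_def K0_def\<close>)
    finally show ?thesis by simp
  qed
  ultimately show thesis
    using that[of "K0 \<union> K1"] K0E K1E H(3) unfolding w_def by fastforce
qed

text \<open>Induction starting at \<open>l = t\<close>, where \<open>{..<t}\<close> is the only
  possible member and has \<open>(n - t) choose (k - t)\<close> extensions.\<close>

lemma t_intersecting_weight_bound: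
  assumes "0 < t" "t \<le> k" "(k - t + 1) * (t + 1) \<le> n" "t \<le> l" "l \<le> n"
    and "G \<subseteq> Pow {..<l}" "t_intersecting t G"
  shows "(\<Sum>X\<in>G. ext_count n k l (card X)) \<le> (n - t) choose (k - t)"
  using assms(4-)
proof (induction l arbitrary: G rule: dec_induct)
  case base
  have "X = {..<t}" if "X \<in> G" for X
  proof -
    have "X \<subseteq> {..<t}" "t \<le> card X" using that base t_intersecting_card by auto
    then show ?thesis using card_seteq[of "{..<t}" X] by simp
  qed
  then have "(\<Sum>X\<in>G. ext_count n k t (card X)) \<le> (\<Sum>X\<in>{{..<t}}. ext_count n k t (card X))"
    by (intro sum_mono2) auto
  then show ?case using assms(2) by (simp add: ext_count_def)
next
  case (step l)
  obtain K where "K \<subseteq> Pow {..<l}" "t_intersecting t K"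
    "(\<Sum>X\<in>G. ext_count n k (Suc l) (card X)) \<le> (\<Sum>X\<in>K. ext_count n k l (card X))"
    using restrict_last_coordinate[OF assms(1) step.hyps(1) _ assms(2,3) step.prems(2,3)] step.prems(1) by auto
  then show ?case using step.IH[of K] step.prems(1) by simp
qed

theorem Erdos_Ko_Rado_Wilson:
  assumes "t \<le> k" "k \<le> n" "(k - t + 1) * (t + 1) \<le> n"
    and "F \<subseteq> {A. A \<subseteq> {..<n} \<and> card A = k}" "t_intersecting t F"
  shows "card F \<le> (n - t) choose (k - t)"
proof (cases "t = 0")
  \<comment> \<open>The descent works for positive \<open>t\<close>; here the bound is the number of
    all \<open>k\<close>-sets.\<close>
  case True
  have "card F \<le> card {A. A \<subseteq> {..<n} \<and> card A = k}" by (rule card_mono) (use assms(4) in auto)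
  then show ?thesis using True by (simp add: n_subsets)
next
  case False
  \<comment> \<open>At \<open>l = n\<close> a \<open>k\<close>-set has one extension, itself, so
    weight is cardinality.\<close>
  have "card F = (\<Sum>X\<in>F. ext_count n k n (card X))"
    using assms(4) by (subst sum.cong[where h = "\<lambda>_. 1"]) (auto simp: ext_count_def)
  also have "\<dots> \<le> (n - t) choose (k - t)"
    using assms False by (intro t_intersecting_weight_bound) auto
  finally show ?thesis .
qed

section \<open>Anticodes of words of constant weight\<close>

definition words_on :: "nat \<Rightarrow> nat \<Rightarrow> nat set \<Rightarrow> (nat \<Rightarrow> nat) set" where
  "words_on q n S = {x \<in> words q n. supp n x = S}"

lemma card_words_on:
  assumes "S \<subseteq> {..<n}" "0 < q"
  shows "card (words_on q n S) = (q - 1) ^ card S" "finite (words_on q n S)"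
proof -
  have finS: "finite S" using assms(1) by (rule finite_subset) simp
  let ?P = "PiE S (\<lambda>_. {1..<q})"
  have "bij_betw (\<lambda>x. restrict x S) (words_on q n S) ?P"
  proof (rule bij_betw_byWitness[where f' = "\<lambda>y i. if i \<in> S then y i else 0"])
    have zero: "x i = 0" if "x \<in> words_on q n S" "i \<notin> S" for x i
      using that by (cases "i < n") (auto simp: words_on_def words_def supp_def)
    show "\<forall>x\<in>words_on q n S. (\<lambda>i. if i \<in> S then restrict x S i else 0) = x"
      using zero by (auto simp: fun_eq_iff)
    show "\<forall>y\<in>?P. restrict (\<lambda>i. if i \<in> S then y i else 0) S = y"
      by (auto simp: fun_eq_iff restrict_def PiE_def extensional_def)
    show "(\<lambda>x. restrict x S) ` words_on q n S \<subseteq> ?P"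
      by (auto simp: words_on_def words_def supp_def)
    have "(\<lambda>i. if i \<in> S then y i else 0) \<in> words_on q n S" if "y \<in> ?P" for y
    proof -
      have y: "1 \<le> y i \<and> y i < q" if "i \<in> S" for i using \<open>y \<in> ?P\<close> that by (auto simp: PiE_iff)
      have "supp n (\<lambda>i. if i \<in> S then y i else 0) = S"
        using y assms(1) by (force simp: supp_def)
      moreover have "(\<lambda>i. if i \<in> S then y i else 0) \<in> words q n"
        using y assms by (auto simp: words_def)
      ultimately show ?thesis by (simp add: words_on_def)
    qed
    then show "(\<lambda>y i. if i \<in> S then y i else 0) ` ?P \<subseteq> words_on q n S" by blast
  qed
  moreover have "card ?P = (q - 1) ^ card S" "finite ?P" using finS by (simp_all add: card_PiE finite_PiE)
  ultimately show "card (words_on q n S) = (q - 1) ^ card S" "finite (words_on q n S)"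
    using bij_betw_same_card bij_betw_finite by metis+
qed

text \<open>Setting coordinate \<open>i\<close> to 0 is injective once its value is prescribed.
  There is no such word if \<open>c\<close> is 0 or at least \<open>q\<close>, hence only an
  inequality.\<close>

lemma card_words_on_fixed_value:
  assumes "T \<subseteq> {..<n}" "0 < q" "i \<in> T"
  shows "card {y \<in> words_on q n T. y i = c} \<le> (q - 1) ^ (card T - 1)"
proof -
  let ?f = "\<lambda>y :: nat \<Rightarrow> nat. y(i := 0)"
  have "card {y \<in> words_on q n T. y i = c} \<le> card (words_on q n (T - {i}))"
  proof (rule card_inj_on_le[of ?f])
    show "inj_on ?f {y \<in> words_on q n T. y i = c}"
      by (rule inj_on_inverseI[of _ "\<lambda>y. y(i := c)"]) auto
    show "?f ` {y \<in> words_on q n T. y i = c} \<subseteq> words_on q n (T - {i})"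
      using assms(2) by (auto simp: words_on_def words_def supp_def split: if_splits)
    show "finite (words_on q n (T - {i}))" using assms(1,2) by (intro card_words_on) auto
  qed
  also have "\<dots> = (q - 1) ^ card (T - {i})" using assms(1,2) by (intro card_words_on) auto
  also have "card (T - {i}) = card T - 1" using assms(3) by simp
  finally show ?thesis .
qed

text \<open>A union bound over the coordinate of agreement. It saves one power of
  \<open>q - 1\<close> against all words on \<open>T\<close>, which makes such groups negligible for
  large \<open>q\<close>.\<close>

lemma card_words_on_meeting:
  assumes "T \<subseteq> {..<n}" "0 < q"
    and "B \<subseteq> words_on q n T" "\<And>y. y \<in> B \<Longrightarrow> \<exists>i\<in>T. y i = x i"
  shows "card B \<le> card T * (q - 1) ^ (card T - 1)"
proof -
  have finT: "finite T" using assms(1) by (rule finite_subset) simp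
  have "B \<subseteq> (\<Union>i\<in>T. {y \<in> words_on q n T. y i = x i})" using assms(3,4) by blast
  then have "card B \<le> card (\<Union>i\<in>T. {y \<in> words_on q n T. y i = x i})"
    by (rule card_mono[rotated]) (use finT card_words_on(2)[OF assms(1,2)] in auto)
  also have "\<dots> \<le> (\<Sum>i\<in>T. card {y \<in> words_on q n T. y i = x i})"
    by (rule card_UN_le[OF finT])
  also have "\<dots> \<le> (\<Sum>i\<in>T. (q - 1) ^ (card T - 1))"
    using assms(1,2) by (intro sum_mono card_words_on_fixed_value)
  finally show ?thesis by simp
qed

section \<open>Size and diameter of \<open>App\<close>\<close>

lemma App_eq_Union: "App q n w t = (\<Union>S\<in>{S. S \<subseteq> {t..<n} \<and> card S = w}. words_on q n S)"
proof (intro set_eqI iffI)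
  fix x assume x: "x \<in> App q n w t"
  then have "supp n x = {i. t \<le> i \<and> i < n \<and> x i \<noteq> 0}"
    by (auto simp: App_def supp_def not_less intro: leI)
  then show "x \<in> (\<Union>S\<in>{S. S \<subseteq> {t..<n} \<and> card S = w}. words_on q n S)"
    using x by (auto simp: App_def words_on_def)
next
  fix x assume "x \<in> (\<Union>S\<in>{S. S \<subseteq> {t..<n} \<and> card S = w}. words_on q n S)"
  then have x: "x \<in> words q n" "supp n x \<subseteq> {t..<n}" "card (supp n x) = w"
    by (auto simp: words_on_def)
  then have "{i. t \<le> i \<and> i < n \<and> x i \<noteq> 0} = supp n x" by (auto simp: supp_def)
  moreover have "x i = 0" if "i < t" for i
    using x(1,2) that by (cases "i < n") (auto simp: words_def supp_def)
  ultimately show "x \<in> App q n w t" using x by (simp add: App_def)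
qed

lemma card_App:
  assumes "0 < q"
  shows "card (App q n w t) = ((n - t) choose w) * (q - 1) ^ w"
proof -
  let ?S = "{S. S \<subseteq> {t..<n} \<and> card S = w}"
  have sub: "S \<subseteq> {..<n}" if "S \<in> ?S" for S using that by auto
  have "card (App q n w t) = (\<Sum>S\<in>?S. card (words_on q n S))"
    unfolding App_eq_Union
  proof (rule card_UN_disjoint)
    show "\<forall>S\<in>?S. finite (words_on q n S)" using card_words_on(2) sub assms by blast
  qed (auto simp: words_on_def)
  also have "\<dots> = (\<Sum>S\<in>?S. (q - 1) ^ w)"
    by (intro sum.cong) (use sub assms in \<open>auto simp: card_words_on\<close>)
  also have "\<dots> = ((n - t) choose w) * (q - 1) ^ w" by (simp add: n_subsets)
  finally show ?thesis .
qed

lemma anticode_App: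
  assumes "t + w \<le> n" "2 \<le> q"
  shows "anticode n (n - t) (J q n w) (App q n w t)"
proof -
  have "0 < card (App q n w t)" using assms by (simp add: card_App)
  then have "App q n w t \<noteq> {}" by auto
  moreover have "App q n w t \<subseteq> J q n w"
    unfolding App_eq_Union by (auto simp: J_def words_on_def wt_def)
  moreover have "hdist n x y \<le> n - t" if "x \<in> App q n w t" "y \<in> App q n w t" for x y
  proof -
    have "{i. i < n \<and> x i \<noteq> y i} \<subseteq> {t..<n}" using that by (force simp: App_def not_less)
    then have "hdist n x y \<le> card {t..<n}" unfolding hdist_def by (intro card_mono) auto
    then show ?thesis by simp
  qed
  ultimately show ?thesis by (simp add: anticode_def)
qed

section \<open>Maximality for large \<open>q\<close>\<close>

lemma Erdos_Ko_Rado_Wilson_complements: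
  assumes "t + w \<le> n" "(n - w - t + 1) * (t + 1) \<le> n"
    and F: "\<And>S. S \<in> F \<Longrightarrow> S \<subseteq> {..<n} \<and> card S = w"
    and int: "\<And>S T. S \<in> F \<Longrightarrow> T \<in> F \<Longrightarrow> t \<le> card ({..<n} - (S \<union> T))"
  shows "card F \<le> (n - t) choose w"
proof -
  have "inj_on (\<lambda>S. {..<n} - S) F"
    by (rule inj_on_inverseI[of _ "\<lambda>S. {..<n} - S"]) (use F in auto)
  then have "card F = card ((\<lambda>S. {..<n} - S) ` F)" by (simp add: card_image)
  \<comment> \<open>Zero sets have size \<open>k = n - w\<close>, and those of \<open>S\<close> and
    \<open>T\<close> meet in the complement of \<open>S \<union> T\<close>.\<close>
  also have "\<dots> \<le> (n - t) choose (n - w - t)"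
  proof (rule Erdos_Ko_Rado_Wilson)
    show "t_intersecting t ((\<lambda>S. {..<n} - S) ` F)"
      using int by (auto simp: t_intersecting_def Diff_Un)
    show "(\<lambda>S. {..<n} - S) ` F \<subseteq> {A. A \<subseteq> {..<n} \<and> card A = n - w}"
    proof safe
      fix S assume "S \<in> F"
      then have S: "S \<subseteq> {..<n}" "card S = w" using F by auto
      then show "card ({..<n} - S) = n - w"
        using finite_subset[OF S(1)] by (simp add: card_Diff_subset)
    qed
  qed (use assms(1,2) in auto)
  also have "\<dots> = (n - t) choose w"
    using assms(1) binomial_symmetric[of w "n - t"] by (simp add: add.commute)
  finally show ?thesis .
qed

text \<open>If all groups are large, the Erdos-Ko-Rado bound counts them. Otherwise a small group
  leaves room for at most \<open>C - 1\<close> large ones, and all small groups together fit into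
  the remaining share \<open>M\<close>.\<close>

lemma anticode_card_le:
  assumes "t + w \<le> n" "(n - w - t + 1) * (t + 1) \<le> n"
    and q: "w * (n choose w) < q"
    and B: "anticode n (n - t) (J q n w) B"
  shows "card B \<le> ((n - t) choose w) * (q - 1) ^ w"
proof -
  define C where "C = (n - t) choose w"
  define M where "M = (q - 1) ^ w"
  \<comment> \<open>The bound for a group whose words all agree with one fixed word somewhere on
    their support; groups above it count as large.\<close>
  define D where "D = w * (q - 1) ^ (w - 1)"
  define U where "U = {S. S \<subseteq> {..<n} \<and> card S = w}"
  define BS where "BS = (\<lambda>S. {x \<in> B. supp n x = S})"
  define G where "G = supp n ` B"
  define F where "F = {S \<in> G. D < card (BS S)}"
  have BJ: "B \<subseteq> J q n w" and dist: "\<And>x y. x \<in> B \<Longrightarrow> y \<in> B \<Longrightarrow> hdist n x y \<le> n - t"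
    using B by (auto simp: anticode_def)
  have q0: "0 < q" using q by simp
  have finU: "finite U" and cardU: "card U = n choose w" by (simp_all add: U_def n_subsets)
  have GU: "G \<subseteq> U" using BJ by (auto simp: G_def U_def J_def wt_def supp_def)
  have finG: "finite G" using GU finU by (rule finite_subset)
  have BS: "BS S \<subseteq> words_on q n S" for S using BJ by (auto simp: BS_def words_on_def J_def)
  have SU: "S \<subseteq> {..<n}" "card S = w" if "S \<in> G" for S using that GU by (auto simp: U_def)
  have finBS: "finite (BS S)" if "S \<in> G" for S
    using BS card_words_on(2)[OF SU(1)[OF that] q0] by (rule finite_subset)
  have BS_le: "card (BS S) \<le> M" if "S \<in> G" for S
    using card_mono[OF card_words_on(2)[OF SU(1)[OF that] q0] BS] card_words_on(1)[OF SU(1)[OF that] q0] SU(2)[OF that]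
    by (simp add: M_def)
  have agree: "t \<le> card {i. i < n \<and> x i = y i}" if "x \<in> B" "y \<in> B" for x y
  proof -
    have "{..<n} = {i. i < n \<and> x i \<noteq> y i} \<union> {i. i < n \<and> x i = y i}" by auto
    then have "n = card ({i. i < n \<and> x i \<noteq> y i} \<union> {i. i < n \<and> x i = y i})" by (metis card_lessThan)
    also have "\<dots> = hdist n x y + card {i. i < n \<and> x i = y i}"
      unfolding hdist_def by (rule card_Un_disjoint) auto
    finally show ?thesis using dist[OF that] assms(1) by linarith
  qed
  \<comment> \<open>Words of \<open>B\<close> agree in at least \<open>t\<close> places. If fewer
    than \<open>t\<close> of these can be common zeros, some agreement lies in
    \<open>T\<close>.\<close>
  have conflict: "card (BS T) \<le> D"
    if S: "S \<in> G" and T: "T \<in> G" and less: "card ({..<n} - (S \<union> T)) < t" for S T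
  proof -
    obtain x where x: "x \<in> B" "supp n x = S" using S by (auto simp: G_def)
    have "\<exists>i\<in>T. y i = x i" if y: "y \<in> BS T" for y
    proof (rule ccontr)
      assume no: "\<not> ?thesis"
      have yB: "y \<in> B" "supp n y = T" using y by (auto simp: BS_def)
      have "{i. i < n \<and> x i = y i} \<subseteq> {..<n} - (S \<union> T)"
      proof
        fix i assume i: "i \<in> {i. i < n \<and> x i = y i}"
        then have "i \<notin> T" using no by auto
        then show "i \<in> {..<n} - (S \<union> T)" using i x(2) yB(2) by (auto simp: supp_def)
      qed
      then have "card {i. i < n \<and> x i = y i} \<le> card ({..<n} - (S \<union> T))" by (rule card_mono[rotated]) simp
      with agree[OF x(1) yB(1)] less show False by simp
    qed
    from card_words_on_meeting[OF SU(1)[OF T] q0 BS this] show ?thesis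
      by (simp add: SU(2)[OF T] D_def)
  qed
  have EKR: "card F' \<le> C" if "F' \<subseteq> G" "\<And>S T. S \<in> F' \<Longrightarrow> T \<in> F' \<Longrightarrow> t \<le> card ({..<n} - (S \<union> T))" for F'
    unfolding C_def
  proof (rule Erdos_Ko_Rado_Wilson_complements[OF assms(1,2) _ that(2)])
    show "S \<subseteq> {..<n} \<and> card S = w" if "S \<in> F'" for S
      using SU[of S] \<open>F' \<subseteq> G\<close> that by blast
  qed
  have "B = (\<Union>S\<in>G. BS S)" by (auto simp: BS_def G_def)
  then have "card B = card (\<Union>S\<in>G. BS S)" by simp
  also have "\<dots> = (\<Sum>S\<in>G. card (BS S))"
    by (rule card_UN_disjoint) (use finG finBS in \<open>auto simp: BS_def\<close>)
  finally have cB: "card B = (\<Sum>S\<in>G. card (BS S))" .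
  have FG: "F \<subseteq> G" by (auto simp: F_def)
  \<comment> \<open>Only \<open>T\<close> needs a large group: any occurring \<open>S\<close> in
    conflict with \<open>T\<close> would make the group of \<open>T\<close> small.\<close>
  have F_int: "t \<le> card ({..<n} - (S \<union> T))" if "S \<in> G" "T \<in> F" for S T
    using conflict[OF that(1), of T] that(2) by (force simp: F_def)
  show ?thesis
  proof (cases "G = F")
    case True
    have "card B \<le> (\<Sum>S\<in>G. M)" unfolding cB using BS_le by (rule sum_mono)
    also have "\<dots> = card G * M" by simp
    also have "\<dots> \<le> C * M" using EKR[of G] F_int True by (intro mult_right_mono) auto
    finally show ?thesis by (simp add: C_def M_def)
  next
    case False
    then obtain S where S: "S \<in> G" "S \<notin> F" using FG by auto
    \<comment> \<open>The pair \<open>S\<close>, \<open>S\<close> escapes \<open>F_int\<close>,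
      since the group of \<open>S\<close> is small.\<close>
    have self: "t \<le> card ({..<n} - S)"
      using SU[OF S(1)] assms(1) finite_subset[OF SU(1)[OF S(1)]] by (simp add: card_Diff_subset)
    have "card (insert S F) \<le> C"
    proof (rule EKR)
      show "insert S F \<subseteq> G" using S FG by auto
      fix S' T' assume "S' \<in> insert S F" "T' \<in> insert S F"
      then show "t \<le> card ({..<n} - (S' \<union> T'))"
        using F_int[of S' T'] F_int[of T' S'] self FG S by (auto simp: Un_commute)
    qed
    then have FC: "Suc (card F) \<le> C" using S finite_subset[OF FG finG] by simp
    \<comment> \<open>This is where the size of \<open>q\<close> is used; for \<open>w = 0\<close>
      simply \<open>D = 0\<close>.\<close>
    have small: "(n choose w) * D \<le> M"
    proof (cases "w = 0")
      case False
      have "(n choose w) * D = w * (n choose w) * (q - 1) ^ (w - 1)" by (simp add: D_def mult_ac)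
      also have "\<dots> \<le> (q - 1) * (q - 1) ^ (w - 1)" using q by (intro mult_right_mono) auto
      also have "\<dots> = M" using False by (simp add: M_def power_eq_if)
      finally show ?thesis .
    qed (simp add: D_def)
    have "card B = (\<Sum>S\<in>F. card (BS S)) + (\<Sum>S\<in>G - F. card (BS S))"
      unfolding cB using FG finG by (simp add: sum.subset_diff add.commute)
    also have "\<dots> \<le> (\<Sum>S\<in>F. M) + (\<Sum>S\<in>G - F. D)"
      using BS_le FG by (intro add_mono sum_mono) (auto simp: F_def)
    also have "\<dots> = card F * M + card (G - F) * D" by simp
    also have "\<dots> \<le> card F * M + (n choose w) * D"
      using card_mono[OF finU, of "G - F"] GU cardU by (intro add_left_mono mult_right_mono) auto
    also have "\<dots> \<le> Suc (card F) * M" using small by simp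
    also have "\<dots> \<le> C * M" using FC by (rule mult_right_mono) simp
    finally show ?thesis by (simp add: C_def M_def)
  qed
qed

theorem mainTheorem4:
  fixes n w t :: nat
  assumes "t + w \<le> n" and "n \<le> 2 * w + t"
  shows "(\<forall>q\<ge>3. anticode n (n - t) (J q n w) (App q n w t)
                 \<and> card (App q n w t) = ((n - t) choose w) * (q - 1) ^ w)
         \<and> (n \<ge> (n - w - t + 1) * (t + 1) \<longrightarrow>
              (\<exists>Q. \<forall>q\<ge>Q. max_anticode n (n - t) (J q n w) (App q n w t)))"
proof (intro conjI allI impI)
  fix q :: nat assume "3 \<le> q"
  then show "anticode n (n - t) (J q n w) (App q n w t)"
    "card (App q n w t) = ((n - t) choose w) * (q - 1) ^ w"
    using anticode_App[OF assms(1)] card_App by auto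
next
  assume n: "(n - w - t + 1) * (t + 1) \<le> n"
  \<comment> \<open>The summand 2 ensures \<open>2 \<le> q\<close> as well as
    \<open>w * (n choose w) < q\<close>.\<close>
  have "max_anticode n (n - t) (J q n w) (App q n w t)" if "w * (n choose w) + 2 \<le> q" for q
    unfolding max_anticode_def
    using anticode_App[OF assms(1)] anticode_card_le[OF assms(1) n] card_App[of q] that by auto
  then show "\<exists>Q. \<forall>q\<ge>Q. max_anticode n (n - t) (J q n w) (App q n w t)" by blast
qed

end
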